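(* Let $G$ be a bipartite graph with bipartition $(X,Y)$ such that $|X|\leq |Y|$ and $\gamma(G)=|X|$. Then $\gamma_{it}(G)=\gamma(G)+1$ if and only if every vertex in $X$ is either a pendant vertex or is adjacent to at least two pendant vertices.
   Context: All graphs are finite, simple and undirected. A pendant vertex is a vertex of degree $1$. For a graph $G$, a set $S\subseteq V(G)$ is a dominating set if every vertex in $V(G)\setminus S$ is adjacent to a vertex of $S$; the domination number $\gamma(G)$ is the minimum cardinality of a dominating set of $G$. An independent set is a set of pairwise non-adjacent vertices, and the independence number $\alpha(G)$ is the maximum cardinality of an independent set of $G$. A maximum independent set is an independent set of cardinality $\alpha(G)$; $\Omega(G)$ denotes the set of all maximum independent sets of $G$. A dominating set $S$ of $G$ is an independent transversal dominating set if $S\cap I\neq\emptyset$ for every $I\in\Omega(G)$. The independent transversal domination number $\gamma_{it}(G)$ is the minimum cardinality of an independent transversal dominating set of $G$.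
   Formalization: G is assumed nonempty and no vertex of Y is isolated; without the latter the claim fails, e.g. X={x1,x2}, Y={y,z} with edges x1y, x2y only: both vertices of X are pendant, but {y,z} gives γ_it=γ=2. *)

theory Defs
  imports "Graph_Theory.Digraph"
begin

text \<open>
  A finite simple undirected graph is a \<^locale>\<open>graph\<close> of \<^theory>\<open>Graph_Theory.Digraph\<close>: a finite
  digraph without loops and parallel arcs whose arc relation is symmetric. Hence
  \<open>u \<rightarrow>\<^bsub>G\<^esub> v\<close> is adjacency. Each undirected edge is a pair of opposite arcs, exactly one of
  which leaves a given end, so the degree of a vertex is its out-degree.
\<close>

abbreviation degree :: "('a, 'b) pre_digraph \<Rightarrow> 'a \<Rightarrow> nat" where
  "degree \<equiv> out_degree"

definition pendant :: "('a, 'b) pre_digraph \<Rightarrow> 'a \<Rightarrow> bool" where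
  "pendant G v \<longleftrightarrow> v \<in> verts G \<and> degree G v = 1"

definition bipartition :: "('a, 'b) pre_digraph \<Rightarrow> 'a set \<Rightarrow> 'a set \<Rightarrow> bool" where
  "bipartition G X Y \<longleftrightarrow>
     X \<union> Y = verts G \<and> X \<inter> Y = {} \<and>
     (\<forall>u v. u \<rightarrow>\<^bsub>G\<^esub> v \<longrightarrow> (u \<in> X \<and> v \<in> Y) \<or> (u \<in> Y \<and> v \<in> X))"

definition dominating_set :: "('a, 'b) pre_digraph \<Rightarrow> 'a set \<Rightarrow> bool" where
  "dominating_set G S \<longleftrightarrow>
     S \<subseteq> verts G \<and> (\<forall>v \<in> verts G - S. \<exists>s \<in> S. v \<rightarrow>\<^bsub>G\<^esub> s)"

definition domination_number :: "('a, 'b) pre_digraph \<Rightarrow> nat" where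
  "domination_number G = Min (card ` {S. dominating_set G S})"

definition independent_set :: "('a, 'b) pre_digraph \<Rightarrow> 'a set \<Rightarrow> bool" where
  "independent_set G I \<longleftrightarrow>
     I \<subseteq> verts G \<and> (\<forall>u \<in> I. \<forall>v \<in> I. \<not> u \<rightarrow>\<^bsub>G\<^esub> v)"

definition independence_number :: "('a, 'b) pre_digraph \<Rightarrow> nat" where
  "independence_number G = Max (card ` {I. independent_set G I})"

definition maximum_independent_sets :: "('a, 'b) pre_digraph \<Rightarrow> 'a set set" where
  "maximum_independent_sets G = {I. independent_set G I \<and> card I = independence_number G}"

definition it_dominating_set :: "('a, 'b) pre_digraph \<Rightarrow> 'a set \<Rightarrow> bool" where
  "it_dominating_set G S \<longleftrightarrow>
     dominating_set G S \<and> (\<forall>I \<in> maximum_independent_sets G. S \<inter> I \<noteq> {})"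

text \<open>
  The null graph has no independent transversal dominating set, because its only maximum
  independent set is empty; the following number is meaningful only if \<open>verts G \<noteq> {}\<close>, in
  which case \<open>verts G\<close> itself is such a set.
\<close>

definition it_domination_number :: "('a, 'b) pre_digraph \<Rightarrow> nat" where
  "it_domination_number G = Min (card ` {S. it_dominating_set G S})"

end

theory Submission
  imports Defs
begin

text \<open>
  If some vertex of \<open>X\<close> is isolated, it lies in every maximum independent set and in every
  dominating set, so \<open>\<gamma>\<^sub>i\<^sub>t = \<gamma>\<close>, and that vertex also violates the condition on pendant
  vertices. The vertices of \<open>Y\<close> are not isolated by assumption, so from here on no vertex is.

  The equation \<open>\<gamma> = \<bar>X\<bar>\<close> is used through an exchange: for \<open>S \<subseteq> X\<close>, replacing \<open>S\<close> by its
  neighbourhood \<open>N(S)\<close> keeps \<open>X\<close> dominating, so \<open>\<bar>S\<bar> \<le> \<bar>N(S)\<bar>\<close> (\<open>hall_condition\<close>). An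
  independent set that meets \<open>X\<close> in \<open>S\<close> misses \<open>N(S)\<close>, hence has at most
  \<open>\<bar>S\<bar> + \<bar>Y\<bar> - \<bar>N(S)\<bar> \<le> \<bar>Y\<bar>\<close> elements. So \<open>\<alpha> = \<bar>Y\<bar>\<close>, and every tight \<open>S\<close>, one with
  \<open>\<bar>N(S)\<bar> = \<bar>S\<bar>\<close>, gives a maximum independent set \<open>S \<union> (Y - N(S))\<close>. A maximum
  independent set contained in \<open>Y\<close> must be \<open>Y\<close>, so \<open>X\<close> with one vertex of \<open>Y\<close> added is
  transversal. Thus \<open>\<gamma>\<^sub>i\<^sub>t\<close> is \<open>\<bar>X\<bar>\<close> or \<open>\<bar>X\<bar> + 1\<close>, and the question is whether some
  dominating set of size \<open>\<bar>X\<bar>\<close> is transversal.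

  If a vertex \<open>x \<in> X\<close> is not pendant and has at most one pendant neighbour, exchange \<open>x\<close> for
  that neighbour (or for any neighbour, if none is pendant). The result is dominating, and it
  is transversal: a maximum independent set avoiding it could contain no vertex of \<open>X\<close> but
  \<open>x\<close>, which costs at least two vertices of \<open>Y\<close>, and could not be all of \<open>Y\<close>
  (\<open>swap_it_dominating\<close>).

  Conversely, suppose that each \<open>x \<in> X\<close> is pendant or has two pendant neighbours. Attach to
  \<open>x\<close> the block of \<open>x\<close> and its only neighbour, or of \<open>x\<close> and its pendant neighbours. The
  blocks are disjoint (\<open>block_disjoint\<close>) and each meets every dominating set, so a
  dominating set \<open>D\<close> of size \<open>\<bar>X\<bar>\<close> consists of one vertex from each. It must therefore
  contain every \<open>x\<close> that has two pendant neighbours. Consequently \<open>S = X - D\<close> consists of pendant vertices, \<open>S\<close> is tight,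
  \<open>D \<inter> Y \<subseteq> N(S)\<close>, and the maximum independent set \<open>S \<union> (Y - N(S))\<close> avoids \<open>D\<close>
  (\<open>minimum_dominating_not_transversal\<close>).
\<close>

section \<open>Neighbourhoods, domination and independence in finite graphs\<close>

definition neighbours :: "('a, 'b) pre_digraph \<Rightarrow> 'a set \<Rightarrow> 'a set" where
  "neighbours G S = {v. \<exists>s \<in> S. s \<rightarrow>\<^bsub>G\<^esub> v}"

lemma neighbours_singleton: "neighbours G {v} = {w. v \<rightarrow>\<^bsub>G\<^esub> w}"
  by (simp add: neighbours_def)

lemma neighbours_UN: "neighbours G S = (\<Union>s \<in> S. neighbours G {s})"
  by (auto simp: neighbours_def)

context graph
begin

lemma adj_sym: "u \<rightarrow>\<^bsub>G\<^esub> v \<longleftrightarrow> v \<rightarrow>\<^bsub>G\<^esub> u"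
  using sym_arcs by (auto simp: symmetric_def dest: symD)

lemma neighbours_subset: "neighbours G S \<subseteq> verts G"
  by (auto simp: neighbours_def)

lemma finite_neighbours: "finite (neighbours G S)"
  using neighbours_subset finite_verts finite_subset by blast

text \<open>
  Because there are no parallel arcs, counting the arcs that leave a vertex is the same as
  counting its neighbours.
\<close>

lemma degree_eq_card_neighbours: "degree G v = card (neighbours G {v})"
proof -
  have "bij_betw (head G) (out_arcs G v) (neighbours G {v})"
  proof (rule bij_betw_imageI)
    show "inj_on (head G) (out_arcs G v)"
      using no_multi_arcs by (auto simp: inj_on_def arc_to_ends_def)
    show "head G ` out_arcs G v = neighbours G {v}"
      by (auto simp: neighbours_def arcs_ends_def arc_to_ends_def image_iff)
  qed
  then show ?thesis
    by (auto simp: out_degree_def bij_betw_same_card)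
qed

lemma degree_eq_0_iff: "degree G v = 0 \<longleftrightarrow> (\<forall>w. \<not> v \<rightarrow>\<^bsub>G\<^esub> w)"
  using finite_neighbours[of "{v}"] by (auto simp: degree_eq_card_neighbours neighbours_def)

lemma pendant_unique_neighbour:
  assumes "pendant G v" "v \<rightarrow>\<^bsub>G\<^esub> u" "v \<rightarrow>\<^bsub>G\<^esub> w"
  shows "u = w"
proof -
  have "card (neighbours G {v}) = 1"
    using assms(1) by (simp add: pendant_def degree_eq_card_neighbours)
  then obtain a where "neighbours G {v} = {a}"
    by (auto simp: card_1_singleton_iff)
  then show ?thesis
    using assms(2,3) by (metis mem_Collect_eq neighbours_singleton singletonD)
qed

lemma finite_dominating_sets: "finite {S. dominating_set G S}"
  by (rule finite_subset[of _ "Pow (verts G)"]) (auto simp: dominating_set_def)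

lemma finite_it_dominating_sets: "finite {S. it_dominating_set G S}"
  by (rule finite_subset[OF _ finite_dominating_sets]) (auto simp: it_dominating_set_def)

lemma finite_independent_sets: "finite {I. independent_set G I}"
  by (rule finite_subset[of _ "Pow (verts G)"]) (auto simp: independent_set_def)

lemma domination_number_le: "dominating_set G S \<Longrightarrow> domination_number G \<le> card S"
  unfolding domination_number_def
  by (rule Min_le) (auto simp: finite_dominating_sets)

lemma it_domination_number_le: "it_dominating_set G S \<Longrightarrow> it_domination_number G \<le> card S"
  unfolding it_domination_number_def
  by (rule Min_le) (auto simp: finite_it_dominating_sets)

lemma independence_number_ge: "independent_set G I \<Longrightarrow> card I \<le> independence_number G"
  unfolding independence_number_def
  by (rule Max_ge) (auto simp: finite_independent_sets)

lemma dominating_set_verts: "dominating_set G (verts G)"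
  by (simp add: dominating_set_def)

lemma domination_number_attained:
  obtains S where "dominating_set G S" "card S = domination_number G"
proof -
  have "domination_number G \<in> card ` {S. dominating_set G S}"
    unfolding domination_number_def
    by (rule Min_in) (use dominating_set_verts in \<open>auto simp: finite_dominating_sets\<close>)
  then show ?thesis
    using that by auto
qed

lemma it_domination_number_attained:
  assumes "it_dominating_set G T"
  obtains S where "it_dominating_set G S" "card S = it_domination_number G"
proof -
  have "it_domination_number G \<in> card ` {S. it_dominating_set G S}"
    unfolding it_domination_number_def
    by (rule Min_in) (use assms in \<open>auto simp: finite_it_dominating_sets\<close>)
  then show ?thesis
    using that by auto
qed

lemma independence_number_attained:
  obtains I where "independent_set G I" "card I = independence_number G"
proof -
  have "independent_set G {}"
    by (simp add: independent_set_def)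
  then have "independence_number G \<in> card ` {I. independent_set G I}"
    unfolding independence_number_def
    by (intro Max_in) (auto simp: finite_independent_sets)
  then show ?thesis
    using that by auto
qed

text \<open>
  An isolated vertex can be added to every independent set and can be dominated only by
  itself. Hence it lies in every maximum independent set and in every dominating set, and
  transversality costs nothing.
\<close>

lemma dominating_set_transversal_if_isolated:
  assumes "v \<in> verts G" "degree G v = 0" "dominating_set G S"
  shows "it_dominating_set G S"
proof -
  have isolated: "\<not> v \<rightarrow>\<^bsub>G\<^esub> w" "\<not> w \<rightarrow>\<^bsub>G\<^esub> v" for w
    using assms(2) adj_sym by (auto simp: degree_eq_0_iff)
  have "v \<in> S"
    using assms(1,3) isolated by (metis DiffI dominating_set_def)
  moreover have "v \<in> I" if I: "I \<in> maximum_independent_sets G" for I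
  proof (rule ccontr)
    assume "v \<notin> I"
    moreover have "finite I"
      using I finite_verts
      by (auto simp: maximum_independent_sets_def independent_set_def intro: finite_subset)
    moreover have "independent_set G (insert v I)"
      using I assms(1) isolated
      by (auto simp: maximum_independent_sets_def independent_set_def)
    ultimately show False
      using I independence_number_ge[of "insert v I"]
      by (simp add: maximum_independent_sets_def)
  qed
  ultimately show ?thesis
    using assms(3) by (auto simp: it_dominating_set_def)
qed

end

section \<open>Bipartite graphs dominated optimally by one side\<close>

text \<open>
  The side \<open>X\<close> dominates because there are no isolated vertices; the equation for the
  domination number says that it does so optimally.
\<close>

locale bipartite_dominated = graph G for G :: "('a, 'b) pre_digraph" +
  fixes X Y :: "'a set"
  assumes bipartition: "bipartition G X Y"
    and no_isolated: "v \<in> verts G \<Longrightarrow> degree G v \<noteq> 0"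
    and domination_number_eq: "domination_number G = card X"
    and nonempty: "verts G \<noteq> {}"
begin

lemma verts_eq: "verts G = X \<union> Y" and disjoint: "X \<inter> Y = {}"
  using bipartition by (auto simp: bipartition_def)

lemma finite_X: "finite X" and finite_Y: "finite Y"
  using finite_verts verts_eq by auto

lemma adj_X: "x \<in> X \<Longrightarrow> x \<rightarrow>\<^bsub>G\<^esub> v \<Longrightarrow> v \<in> Y"
  and adj_Y: "y \<in> Y \<Longrightarrow> y \<rightarrow>\<^bsub>G\<^esub> v \<Longrightarrow> v \<in> X"
  using bipartition by (auto simp: bipartition_def)

lemma neighbours_X: "S \<subseteq> X \<Longrightarrow> neighbours G S \<subseteq> Y"
  using adj_X by (auto simp: neighbours_def)

lemma obtain_neighbour:
  assumes "v \<in> verts G"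
  obtains w where "v \<rightarrow>\<^bsub>G\<^esub> w"
  using no_isolated[OF assms] by (auto simp: degree_eq_0_iff)

lemma Y_nonempty: "Y \<noteq> {}"
proof -
  obtain v where v: "v \<in> verts G"
    using nonempty by auto
  then obtain w where "v \<rightarrow>\<^bsub>G\<^esub> w"
    using obtain_neighbour by blast
  then show ?thesis
    using v verts_eq adj_X by auto
qed

text \<open>
  A vertex of \<open>S\<close> is dominated by any of its neighbours. A vertex of \<open>Y\<close> outside \<open>N(S)\<close>
  has all its neighbours, of which there is at least one, in \<open>X - S\<close>.
\<close>

lemma exchange_dominating:
  assumes "S \<subseteq> X"
  shows "dominating_set G ((X - S) \<union> neighbours G S)"
  unfolding dominating_set_def
proof (intro conjI ballI)
  show "(X - S) \<union> neighbours G S \<subseteq> verts G"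
    using verts_eq neighbours_subset by auto
next
  fix v assume v: "v \<in> verts G - ((X - S) \<union> neighbours G S)"
  then obtain w where w: "v \<rightarrow>\<^bsub>G\<^esub> w"
    using obtain_neighbour by blast
  show "\<exists>s \<in> (X - S) \<union> neighbours G S. v \<rightarrow>\<^bsub>G\<^esub> s"
  proof (cases "v \<in> X")
    case True
    then have "w \<in> neighbours G S"
      using v w by (auto simp: neighbours_def)
    then show ?thesis
      using w by blast
  next
    case False
    then have "w \<in> X"
      using v w verts_eq adj_Y by auto
    moreover have "w \<notin> S"
      using v w adj_sym by (auto simp: neighbours_def)
    ultimately show ?thesis
      using w by blast
  qed
qed

lemma X_dominating: "dominating_set G X"
  using exchange_dominating[of "{}"] by (simp add: neighbours_def)

text \<open>
  This is Hall's condition for a matching that saturates \<open>X\<close>: a violating set could be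
  exchanged for its smaller neighbourhood, giving a dominating set below the optimum. The
  counting arguments below use the condition itself rather than a matching.
\<close>

lemma hall_condition:
  assumes "S \<subseteq> X"
  shows "card S \<le> card (neighbours G S)"
proof -
  have "card X \<le> card ((X - S) \<union> neighbours G S)"
    using domination_number_le[OF exchange_dominating[OF assms]] domination_number_eq by simp
  also have "\<dots> \<le> card (X - S) + card (neighbours G S)"
    by (rule card_Un_le)
  also have "card (X - S) = card X - card S"
    using assms finite_X finite_subset card_Diff_subset by metis
  finally show ?thesis
    using card_mono[OF finite_X assms] by linarith
qed

text \<open>
  The part of \<open>I\<close> in \<open>Y\<close> must avoid the neighbours of the part in \<open>X\<close>. The inequality is
  arranged without subtraction because the cardinalities are natural numbers.
\<close>

lemma independent_set_card_le:
  assumes "independent_set G I"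
  shows "card I + card (neighbours G (I \<inter> X)) \<le> card Y + card (I \<inter> X)"
proof -
  let ?N = "neighbours G (I \<inter> X)"
  have "I = (I \<inter> X) \<union> (I \<inter> Y)"
    using assms verts_eq by (auto simp: independent_set_def)
  then have "card I \<le> card (I \<inter> X) + card (I \<inter> Y)"
    by (metis card_Un_le)
  moreover have "card (I \<inter> Y) + card ?N \<le> card Y"
  proof -
    have "(I \<inter> Y) \<inter> ?N = {}"
      using assms by (auto simp: independent_set_def neighbours_def)
    then have "card (I \<inter> Y) + card ?N = card ((I \<inter> Y) \<union> ?N)"
      using finite_Y finite_neighbours by (simp add: card_Un_disjoint)
    also have "\<dots> \<le> card Y"
      using finite_Y neighbours_X[of "I \<inter> X"] by (intro card_mono) auto
    finally show ?thesis .
  qed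
  ultimately show ?thesis
    by linarith
qed

lemma independence_number_eq: "independence_number G = card Y"
proof (rule antisym)
  obtain I where I: "independent_set G I" "card I = independence_number G"
    by (rule independence_number_attained)
  show "independence_number G \<le> card Y"
    using independent_set_card_le[OF I(1)] hall_condition[of "I \<inter> X"] I(2) by simp
  have "independent_set G Y"
    using verts_eq disjoint adj_Y by (auto simp: independent_set_def)
  then show "card Y \<le> independence_number G"
    by (rule independence_number_ge)
qed

text \<open>
  Exchanging the neighbours of a tight set for the set itself turns the maximum independent
  set \<open>Y\<close> into another one. This supplies the independent sets that a minimum dominating set
  fails to meet.
\<close>

lemma tight_set_maximum_independent:
  assumes "S \<subseteq> X" "card (neighbours G S) \<le> card S"
  shows "S \<union> (Y - neighbours G S) \<in> maximum_independent_sets G"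
proof -
  let ?I = "S \<union> (Y - neighbours G S)"
  have ind: "independent_set G ?I"
    unfolding independent_set_def
  proof (intro conjI ballI notI)
    show "?I \<subseteq> verts G"
      using assms(1) verts_eq by auto
  next
    fix u v assume u: "u \<in> ?I" and v: "v \<in> ?I" and uv: "u \<rightarrow>\<^bsub>G\<^esub> v"
    have vu: "v \<rightarrow>\<^bsub>G\<^esub> u"
      using uv adj_sym by blast
    show False
    proof (cases "u \<in> S")
      case True
      then have "v \<in> Y" "v \<in> neighbours G S"
        using uv assms(1) adj_X by (auto simp: neighbours_def)
      then show False
        using v assms(1) disjoint by auto
    next
      case False
      then have "u \<in> Y" "u \<notin> neighbours G S"
        using u by auto
      then have "v \<in> X" "v \<notin> S"
        using uv vu adj_Y by (auto simp: neighbours_def)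
      then show False
        using v disjoint by auto
    qed
  qed
  have "card ?I = card S + card (Y - neighbours G S)"
    using assms(1) finite_X finite_Y disjoint finite_subset
    by (intro card_Un_disjoint) auto
  also have "card (Y - neighbours G S) = card Y - card (neighbours G S)"
    using neighbours_X[OF assms(1)] finite_neighbours by (intro card_Diff_subset)
  finally have "card Y \<le> card ?I"
    using assms(2) by linarith
  then show ?thesis
    using ind independence_number_ge[OF ind] independence_number_eq
    by (auto simp: maximum_independent_sets_def)
qed

text \<open>
  Only maximum independent sets inside \<open>Y\<close> can avoid \<open>X\<close>, and by cardinality \<open>Y\<close> is the
  only one of these.
\<close>

lemma insert_it_dominating:
  assumes "y \<in> Y"
  shows "it_dominating_set G (insert y X)"
  unfolding it_dominating_set_def
proof (intro conjI ballI notI)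
  show "dominating_set G (insert y X)"
    using X_dominating assms verts_eq by (auto simp: dominating_set_def)
next
  fix I assume I: "I \<in> maximum_independent_sets G" and "insert y X \<inter> I = {}"
  then have "I \<subseteq> Y - {y}"
    using verts_eq by (auto simp: maximum_independent_sets_def independent_set_def)
  then have "card I < card Y"
    using assms finite_Y by (intro psubset_card_mono) auto
  then show False
    using I independence_number_eq by (simp add: maximum_independent_sets_def)
qed

lemma it_domination_number_bounds:
  "card X \<le> it_domination_number G" "it_domination_number G \<le> card X + 1"
proof -
  obtain y where y: "y \<in> Y"
    using Y_nonempty by auto
  show "it_domination_number G \<le> card X + 1"
    using it_domination_number_le[OF insert_it_dominating[OF y]] y disjoint finite_X
    by (auto simp: card_insert_if split: if_splits)
  obtain S where "it_dominating_set G S" "card S = it_domination_number G"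
    using it_domination_number_attained[OF insert_it_dominating[OF y]] .
  then show "card X \<le> it_domination_number G"
    using domination_number_le[of S] domination_number_eq by (auto simp: it_dominating_set_def)
qed

section \<open>A transversal dominating set of minimum size\<close>

text \<open>
  The vertex \<open>x\<close> is exchanged for a neighbour \<open>y\<close> chosen so that every pendant neighbour of
  \<open>x\<close> equals \<open>y\<close>. The other neighbours of \<open>x\<close> then have a second neighbour in \<open>X\<close> that
  still dominates them. A maximum independent set avoiding the new set would have to contain
  \<open>x\<close>, as it cannot be \<open>Y\<close>; but adding \<open>x\<close> alone excludes at least two vertices of \<open>Y\<close>.
\<close>

lemma swap_it_dominating:
  assumes x: "x \<in> X" and not_pendant: "\<not> pendant G x"
    and few: "card {v. x \<rightarrow>\<^bsub>G\<^esub> v \<and> pendant G v} < 2"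
  obtains D where "it_dominating_set G D" "card D = card X"
proof -
  let ?L = "{v. x \<rightarrow>\<^bsub>G\<^esub> v \<and> pendant G v}"
  have finL: "finite ?L"
    by (rule finite_subset[OF _ finite_neighbours[of "{x}"]]) (auto simp: neighbours_def)
  obtain y where xy: "x \<rightarrow>\<^bsub>G\<^esub> y" and L: "?L \<subseteq> {y}"
  proof (cases "?L = {}")
    case True
    obtain y where "x \<rightarrow>\<^bsub>G\<^esub> y"
      using obtain_neighbour[of x] x verts_eq by auto
    then show ?thesis
      using True that by auto
  next
    case False
    then have "card ?L = 1"
      using few finL by (metis One_nat_def card_eq_0_iff less_2_cases)
    then obtain y where "?L = {y}"
      by (auto simp: card_1_singleton_iff)
    then show ?thesis
      using that by blast
  qed
  let ?D = "insert y (X - {x})"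
  have y: "y \<in> Y"
    using x xy adj_X by blast
  have "dominating_set G ?D"
    unfolding dominating_set_def
  proof (intro conjI ballI)
    show "?D \<subseteq> verts G"
      using y verts_eq by auto
  next
    fix v assume v: "v \<in> verts G - ?D"
    show "\<exists>s \<in> ?D. v \<rightarrow>\<^bsub>G\<^esub> s"
    proof (cases "v \<in> X")
      case True
      then show ?thesis
        using v xy by auto
    next
      case False
      then have vY: "v \<in> Y"
        using v verts_eq by auto
      have "\<exists>w. v \<rightarrow>\<^bsub>G\<^esub> w \<and> w \<noteq> x"
      proof (rule ccontr)
        assume *: "\<nexists>w. v \<rightarrow>\<^bsub>G\<^esub> w \<and> w \<noteq> x"
        obtain w where "v \<rightarrow>\<^bsub>G\<^esub> w"
          using obtain_neighbour v by blast
        with * have vx: "v \<rightarrow>\<^bsub>G\<^esub> x" and "neighbours G {v} = {x}"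
          by (auto simp: neighbours_def)
        then have "pendant G v"
          using v by (simp add: pendant_def degree_eq_card_neighbours)
        then have "v \<in> ?L"
          using vx adj_sym by auto
        then show False
          using L v by auto
      qed
      then show ?thesis
        using vY adj_Y by auto
    qed
  qed
  moreover have "?D \<inter> I \<noteq> {}" if I: "I \<in> maximum_independent_sets G" for I
  proof
    assume disj: "?D \<inter> I = {}"
    have ind: "independent_set G I" and cardI: "card I = card Y"
      using I independence_number_eq by (auto simp: maximum_independent_sets_def)
    show False
    proof (cases "x \<in> I")
      case True
      then have IX: "I \<inter> X = {x}"
        using disj x by auto
      have "degree G x \<noteq> 0" "degree G x \<noteq> 1"
        using no_isolated not_pendant x verts_eq by (auto simp: pendant_def)
      then show False
        using independent_set_card_le[OF ind] cardI by (simp add: IX degree_eq_card_neighbours)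
    next
      case False
      then have "I \<subseteq> Y - {y}"
        using disj ind verts_eq by (auto simp: independent_set_def)
      then have "card I < card Y"
        using y finite_Y by (intro psubset_card_mono) auto
      then show False
        using cardI by simp
    qed
  qed
  ultimately have "it_dominating_set G ?D"
    by (simp add: it_dominating_set_def)
  moreover have "card ?D = card X"
    using x y disjoint finite_X card_Suc_Diff1[of X x] by (subst card_insert_disjoint) auto
  ultimately show ?thesis
    using that by blast
qed

section \<open>Dominating sets of minimum size that miss a maximum independent set\<close>

text \<open>
  A set of vertices attached to \<open>x\<close> that every dominating set has to meet, provided that \<open>x\<close>
  is pendant or has a pendant neighbour. For pendant \<open>x\<close> it is the closed neighbourhood of
  \<open>x\<close>; otherwise it is \<open>x\<close> with its pendant neighbours, none of which can be dominated
  except by itself or \<open>x\<close>.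
\<close>

definition block :: "'a \<Rightarrow> 'a set" where
  "block x = insert x {v. x \<rightarrow>\<^bsub>G\<^esub> v \<and> (pendant G x \<or> pendant G v)}"

text \<open>
  A common vertex would be a common neighbour of \<open>x\<close> and \<open>x'\<close>, hence not pendant. Then both
  \<open>x\<close> and \<open>x'\<close> would be pendant with the same only neighbour, against Hall's condition.
\<close>

lemma block_disjoint:
  assumes "x \<in> X" "x' \<in> X" "x \<noteq> x'"
  shows "block x \<inter> block x' = {}"
proof (rule ccontr)
  assume "block x \<inter> block x' \<noteq> {}"
  then obtain v where v: "x \<rightarrow>\<^bsub>G\<^esub> v" "x' \<rightarrow>\<^bsub>G\<^esub> v"
      "pendant G x \<or> pendant G v" "pendant G x' \<or> pendant G v"
    using assms disjoint adj_X by (auto simp: block_def)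
  have "\<not> pendant G v"
    using v(1,2) assms(3) adj_sym pendant_unique_neighbour by blast
  then have "pendant G x" "pendant G x'"
    using v by auto
  then have "neighbours G {x, x'} \<subseteq> {v}"
    using v(1,2) pendant_unique_neighbour by (auto simp: neighbours_def)
  then have "card (neighbours G {x, x'}) \<le> 1"
    using card_mono[of "{v}"] by simp
  moreover have "2 \<le> card (neighbours G {x, x'})"
    using hall_condition[of "{x, x'}"] assms by simp
  ultimately show False
    by simp
qed

text \<open>
  Since \<open>D\<close> has only as many vertices as there are blocks, it has exactly one in each block
  and none elsewhere. Missing an \<open>x\<close> with two pendant neighbours would force both of these
  into \<open>D\<close>, hence two vertices in one block. So \<open>D\<close> misses only pendant vertices of \<open>X\<close>,
  and its vertices in \<open>Y\<close> are neighbours of the missed ones. The tight set of missed vertices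
  therefore yields a maximum independent set that avoids \<open>D\<close>.
\<close>

lemma minimum_dominating_not_transversal:
  assumes D: "dominating_set G D" and cardD: "card D = card X"
    and X: "\<forall>x \<in> X. pendant G x \<or> card {v. x \<rightarrow>\<^bsub>G\<^esub> v \<and> pendant G v} \<ge> 2"
  shows "\<not> it_dominating_set G D"
proof -
  have finD: "finite D"
    using D finite_verts by (auto simp: dominating_set_def intro: finite_subset)
  have leaf_in_D: "v \<in> D" if "x \<rightarrow>\<^bsub>G\<^esub> v" "pendant G v" "x \<notin> D" for x v
  proof (rule ccontr)
    assume "v \<notin> D"
    moreover have "v \<in> verts G"
      using that(1) by auto
    ultimately obtain s where "s \<in> D" "v \<rightarrow>\<^bsub>G\<^esub> s"
      using D by (auto simp: dominating_set_def)
    moreover have "v \<rightarrow>\<^bsub>G\<^esub> x"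
      using that(1) adj_sym by blast
    ultimately show False
      using that(2,3) pendant_unique_neighbour by blast
  qed
  have meets: "\<exists>d. d \<in> D \<inter> block x" if x: "x \<in> X" for x
  proof (cases "x \<in> D \<or> pendant G x")
    case True
    then show ?thesis
      using D x verts_eq by (auto simp: dominating_set_def block_def)
  next
    case False
    then have "card {v. x \<rightarrow>\<^bsub>G\<^esub> v \<and> pendant G v} \<noteq> 0"
      using X x by fastforce
    then obtain v where "x \<rightarrow>\<^bsub>G\<^esub> v" "pendant G v"
      by (metis (mono_tags, lifting) card.empty empty_Collect_eq)
    then show ?thesis
      using False leaf_in_D by (auto simp: block_def)
  qed
  \<comment> \<open>The representatives \<open>g x\<close> are distinct and as many as \<open>D\<close> has vertices, so they exhaust \<open>D\<close>.\<close>
  then obtain g where g: "g x \<in> D" "g x \<in> block x" if "x \<in> X" for x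
    by (metis IntD1 IntD2)
  have "inj_on g X"
    using g block_disjoint by (auto simp: inj_on_def) (metis disjoint_iff)
  then have D_eq: "D = g ` X"
    using g finD cardD by (intro card_subset_eq[symmetric]) (auto simp: card_image)
  have only: "d = g x" if "x \<in> X" "d \<in> D" "d \<in> block x" for x d
    using that D_eq g block_disjoint by (metis disjoint_iff imageE)
  have outside_pendant: "pendant G x" if x: "x \<in> X - D" for x
  proof (rule ccontr)
    assume "\<not> pendant G x"
    then have "card {v. x \<rightarrow>\<^bsub>G\<^esub> v \<and> pendant G v} \<ge> 2"
      using X x by auto
    moreover have "{v. x \<rightarrow>\<^bsub>G\<^esub> v \<and> pendant G v} \<subseteq> {g x}"
      using leaf_in_D only x by (auto simp: block_def)
    ultimately show False
      using card_mono[of "{g x}" "{v. x \<rightarrow>\<^bsub>G\<^esub> v \<and> pendant G v}"] by simp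
  qed
  \<comment> \<open>Each missed vertex has exactly one neighbour, so the missed set is tight.\<close>
  let ?S = "X - D"
  have "card (neighbours G ?S) \<le> (\<Sum>s \<in> ?S. card (neighbours G {s}))"
    using finite_X by (subst neighbours_UN) (simp add: card_UN_le)
  also have "\<dots> = card ?S"
    using outside_pendant by (simp add: pendant_def flip: degree_eq_card_neighbours)
  finally have "?S \<union> (Y - neighbours G ?S) \<in> maximum_independent_sets G"
    by (intro tight_set_maximum_independent) auto
  moreover have "D \<inter> Y \<subseteq> neighbours G ?S"
  proof
    fix d assume d: "d \<in> D \<inter> Y"
    then obtain x where x: "x \<in> X" "d = g x"
      using D_eq by auto
    then have "d \<noteq> x"
      using d disjoint by auto
    moreover have "x \<notin> D"
      using only[of x x] x \<open>d \<noteq> x\<close> by (auto simp: block_def)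
    ultimately show "d \<in> neighbours G ?S"
      using g(2)[of x] x by (auto simp: block_def neighbours_def)
  qed
  then have "D \<inter> (?S \<union> (Y - neighbours G ?S)) = {}"
    by auto
  ultimately show ?thesis
    unfolding it_dominating_set_def by blast
qed

lemma it_domination_number_eq_Suc_iff:
  "it_domination_number G = card X + 1 \<longleftrightarrow>
    (\<forall>x \<in> X. pendant G x \<or> card {v. x \<rightarrow>\<^bsub>G\<^esub> v \<and> pendant G v} \<ge> 2)"
  (is "?lhs \<longleftrightarrow> ?rhs")
proof
  assume ?lhs
  show ?rhs
  proof (rule ccontr)
    assume "\<not> ?rhs"
    then obtain D where "it_dominating_set G D" "card D = card X"
      using swap_it_dominating by (metis not_le)
    then show False
      using \<open>?lhs\<close> it_domination_number_le[of D] by simp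
  qed
next
  assume ?rhs
  obtain y where "y \<in> Y"
    using Y_nonempty by auto
  then obtain D where D: "it_dominating_set G D" "card D = it_domination_number G"
    using it_domination_number_attained[OF insert_it_dominating] by blast
  then have "dominating_set G D"
    by (simp add: it_dominating_set_def)
  then have "card D \<noteq> card X"
    using D(1) minimum_dominating_not_transversal[OF _ _ \<open>?rhs\<close>] by blast
  then show ?lhs
    using D(2) it_domination_number_bounds by linarith
qed

end

section \<open>When the independent transversal domination number exceeds the domination number\<close>

theorem theorem3p2:
  fixes G :: "('a, 'b) pre_digraph" and X Y :: "'a set"
  assumes "graph G"
    and "verts G \<noteq> {}"
    and "bipartition G X Y"
    and "card X \<le> card Y"
    and "domination_number G = card X"
    and no_isolated_in_Y: "\<forall>y \<in> Y. degree G y \<noteq> 0"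
  shows "it_domination_number G = domination_number G + 1 \<longleftrightarrow>
    (\<forall>x \<in> X. pendant G x \<or> card {v. x \<rightarrow>\<^bsub>G\<^esub> v \<and> pendant G v} \<ge> 2)"
proof -
  interpret graph G
    by (fact assms(1))
  show ?thesis
  proof (cases "\<exists>x \<in> X. degree G x = 0")
    case True
    then obtain x where x: "x \<in> X" "degree G x = 0"
      by blast
    then have "x \<in> verts G"
      using assms(3) by (auto simp: bipartition_def)
    moreover obtain S where S: "dominating_set G S" "card S = domination_number G"
      by (rule domination_number_attained)
    ultimately have "it_domination_number G \<le> domination_number G"
      using dominating_set_transversal_if_isolated x(2) it_domination_number_le by metis
    then have "it_domination_number G \<noteq> domination_number G + 1"
      by simp
    moreover have "\<not> pendant G x"
      using x(2) by (simp add: pendant_def)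
    moreover have "{v. x \<rightarrow>\<^bsub>G\<^esub> v \<and> pendant G v} = {}"
      using x(2) degree_eq_0_iff[of x] by auto
    then have "card {v. x \<rightarrow>\<^bsub>G\<^esub> v \<and> pendant G v} = 0"
      by (metis card.empty)
    then have "\<not> card {v. x \<rightarrow>\<^bsub>G\<^esub> v \<and> pendant G v} \<ge> 2"
      by linarith
    ultimately show ?thesis
      using x(1) by blast
  next
    case False
    have "verts G = X \<union> Y"
      using assms(3) by (simp add: bipartition_def)
    then have "degree G v \<noteq> 0" if "v \<in> verts G" for v
      using that False no_isolated_in_Y by auto
    then interpret bipartite_dominated G X Y
      using assms by unfold_locales
    show ?thesis
      using it_domination_number_eq_Suc_iff assms(5) by simp
  qed
qed

end
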